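(* Let $p$ be an odd prime, $l>1$ an integer, $n=p^l$ and $m=\phi(n)$. Then $$\mathrm{Cond}(V_{\Phi_n})\le 4(p-1)m.$$
   Context: $\phi$ is Euler's totient, $\Phi_n$ is the $n$-th cyclotomic polynomial, of degree $m=\phi(n)$, and $\zeta_1,\dots,\zeta_m\in\mathbb{C}$ are the primitive $n$-th roots of unity (in any fixed order). $V_{\Phi_n}$ is the $m\times m$ Vandermonde matrix whose $(i,j)$ entry is $\zeta_i^{\,j-1}$, $1\le i,j\le m$. For a complex matrix $A=(a_{ij})$, $\|A\|=\sqrt{\sum_{i,j}|a_{ij}|^2}$ is the Frobenius norm, and for invertible $A$, $\mathrm{Cond}(A)=\|A\|\,\|A^{-1}\|$. *)

theory Defs
  imports
    "HOL-Number_Theory.Totient"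
    "Jordan_Normal_Form.Gauss_Jordan_Elimination"
    "Jordan_Normal_Form.Determinant"
begin

definition primitive_unity_roots :: "nat \<Rightarrow> complex set" where
  "primitive_unity_roots n = {z. z ^ n = 1 \<and> (\<forall>k. 0 < k \<and> k < n \<longrightarrow> z ^ k \<noteq> 1)}"

(* Matrices and their row and column indices start at 0 here, so the entry z_i^(j-1)
   for 1 <= i, j <= m becomes z i ^ j for i, j < m. *)
definition vandermonde_mat :: "nat \<Rightarrow> (nat \<Rightarrow> complex) \<Rightarrow> complex mat" where
  "vandermonde_mat m z = mat m m (\<lambda>(i, j). z i ^ j)"

definition frobenius_norm :: "complex mat \<Rightarrow> real" where
  "frobenius_norm A = sqrt (\<Sum>i<dim_row A. \<Sum>j<dim_col A. (cmod (A $$ (i, j)))\<^sup>2)"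

(* Meaningful for invertible A only: otherwise mat_inverse A is None. For the Vandermonde
   matrices used here see vandermonde_mat_inverse below. *)
definition matrix_cond :: "complex mat \<Rightarrow> real" where
  "matrix_cond A = frobenius_norm A * frobenius_norm (the (mat_inverse A))"

lemma card_primitive_unity_roots:
  assumes "n > 1"
  shows "card (primitive_unity_roots n) = totient n"
proof -
  define w where "w k = cis (2 * pi * real k / real n)" for k
  have bij: "bij_betw w {..<n} {z. z ^ n = 1}"
    unfolding w_def using bij_betw_roots_unity[of n] assms by simp
  have inj: "inj_on w {..<n}" using bij by (rule bij_betw_imp_inj_on)
  have w_mult: "w (j * k) = w j ^ k" for j k
    by (simp add: w_def Complex.DeMoivre mult_ac)
  have w_add: "w (a + b) = w a * w b" for a b
    by (simp add: w_def cis_mult add_divide_distrib ring_distribs)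
  have w_n: "w n = 1"
    using assms by (simp add: w_def)
  have w_mod: "w (a mod n) = w a" for a
  proof -
    have "w a = w (n * (a div n) + a mod n)" by simp
    also have "\<dots> = w (a mod n)" unfolding w_add w_mult w_n by simp
    finally show ?thesis by simp
  qed
  have w_0: "w 0 = 1" by (simp add: w_def)
  have w_1: "w a = 1 \<longleftrightarrow> n dvd a" for a
  proof -
    have "w a = 1 \<longleftrightarrow> w (a mod n) = w 0" by (simp only: w_mod w_0)
    also have "\<dots> \<longleftrightarrow> a mod n = 0"
      using inj_on_eq_iff[OF inj, of "a mod n" 0] assms by simp
    finally show ?thesis by (simp add: dvd_eq_mod_eq_0)
  qed
  have prim: "w j \<in> primitive_unity_roots n \<longleftrightarrow> coprime j n" for j
  proof -
    have "w j ^ n = 1" unfolding w_mult[symmetric] w_1 by simp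
    then have *: "w j \<in> primitive_unity_roots n \<longleftrightarrow> (\<forall>k. 0 < k \<and> k < n \<longrightarrow> \<not> n dvd j * k)"
      by (simp add: primitive_unity_roots_def w_mult[symmetric] w_1)
    show ?thesis
    proof
      assume "coprime j n"
      then show "w j \<in> primitive_unity_roots n"
        unfolding * by (auto simp: coprime_dvd_mult_right_iff coprime_commute dest: dvd_imp_le)
    next
      assume R: "w j \<in> primitive_unity_roots n"
      show "coprime j n"
      proof (rule ccontr)
        assume nc: "\<not> coprime j n"
        define g where "g = gcd j n"
        have "g \<noteq> 0" "g \<noteq> 1" using nc assms by (auto simp: g_def coprime_iff_gcd_eq_1)
        then have g: "g > 1" by simp
        obtain a b where ab: "j = g * a" "n = g * b"
          unfolding g_def by (meson dvdE gcd_dvd1 gcd_dvd2)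
        have "b > 0" using ab assms by (cases b) auto
        moreover have "b < n" using ab g \<open>b > 0\<close> by simp
        moreover have "n dvd j * b" using ab by simp
        ultimately show False using R unfolding * by blast
      qed
    qed
  qed
  have "primitive_unity_roots n \<subseteq> w ` {..<n}"
    using bij by (auto simp: bij_betw_def primitive_unity_roots_def)
  then have "primitive_unity_roots n = w ` {j \<in> {..<n}. coprime j n}"
    using prim by auto
  moreover have "{j \<in> {..<n}. coprime j n} = totatives n"
    using assms by (auto simp: totatives_def le_less intro!: gr0I)
  moreover have "inj_on w {j \<in> {..<n}. coprime j n}"
    by (rule inj_on_subset[OF inj]) auto
  ultimately show ?thesis by (simp add: card_image totient_def)
qed

lemma vandermonde_mat_det_nonzero:
  assumes "inj_on z {..<m}"
  shows "det (vandermonde_mat m z) \<noteq> 0"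
proof
  have V: "vandermonde_mat m z \<in> carrier_mat m m"
    by (simp add: vandermonde_mat_def)
  assume "det (vandermonde_mat m z) = 0"
  then obtain v where v: "v \<in> carrier_vec m" "v \<noteq> 0\<^sub>v m"
    and Vv: "vandermonde_mat m z *\<^sub>v v = 0\<^sub>v m"
    using det_0_iff_vec_prod_zero[OF V] by blast
  define P where "P = (\<Sum>j<m. monom (v $ j) j)"
  have coeff_P: "coeff P k = (if k < m then v $ k else 0)" for k
    by (simp add: P_def coeff_sum sum.delta')
  have "\<exists>k<m. v $ k \<noteq> 0"
    using v by (metis carrier_vecD eq_vecI index_zero_vec)
  then have P0: "P \<noteq> 0" and m0: "m > 0"
    using coeff_P by (metis coeff_0, auto)
  have "degree P \<le> m - 1"
    by (rule degree_le) (auto simp: coeff_P)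
  have root: "poly P (z i) = 0" if "i < m" for i
  proof -
    have "0 = (vandermonde_mat m z *\<^sub>v v) $ i" using Vv that by simp
    also have "\<dots> = (\<Sum>j<m. z i ^ j * v $ j)"
      using that v by (simp add: vandermonde_mat_def scalar_prod_def lessThan_atLeast0)
    also have "\<dots> = poly P (z i)"
      by (simp add: P_def poly_sum poly_monom mult.commute)
    finally show ?thesis by simp
  qed
  have "m = card (z ` {..<m})" by (simp add: card_image[OF assms])
  also have "\<dots> \<le> card {x. poly P x = 0}"
    by (rule card_mono) (use root poly_roots_finite[OF P0] in auto)
  also have "\<dots> \<le> degree P" by (rule card_poly_roots_bound[OF P0])
  finally show False using \<open>degree P \<le> m - 1\<close> m0 by linarith
qed

lemma vandermonde_mat_inverse:
  assumes "inj_on z {..<m}"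
  obtains B where "mat_inverse (vandermonde_mat m z) = Some B" "B \<in> carrier_mat m m"
    "vandermonde_mat m z * B = 1\<^sub>m m" "B * vandermonde_mat m z = 1\<^sub>m m"
proof (cases "mat_inverse (vandermonde_mat m z)")
  have V: "vandermonde_mat m z \<in> carrier_mat m m"
    by (simp add: vandermonde_mat_def)
  {
    case None
    then have "vandermonde_mat m z \<notin> Units (ring_mat TYPE(complex) m ())"
      using mat_inverse(1)[OF V, where b = "()"] by blast
    then show thesis
      using det_non_zero_imp_unit[OF V vandermonde_mat_det_nonzero[OF assms], where b = "()"]
      by blast
  next
    case (Some B)
    then show thesis using that mat_inverse(2)[OF V Some] by blast
  }
qed

end

(* Write N = p^(l-1), so that n = p N and m = (p-1) N. Every primitive n-th root z satisfies
   Phi_n(z) = 1 + z^N + ... + z^((p-1)N) = 0, and this gives the inverse of the Vandermonde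
   matrix in closed form: its (j,k) entry is (w^j - w^(m + j mod N)) / n with w = 1 / z_k.
   Indeed, with u = z_i / z_k the (i,k) entry of the product collapses to the full geometric sum
   (1 + u + ... + u^(n-1)) / n. All entries of the inverse have modulus at most 2/n, so its norm
   is at most 2m/n <= 2, while the Vandermonde matrix itself has norm m. *)
theory Submission
  imports Defs
begin

lemma frobenius_norm_le:
  assumes "A \<in> carrier_mat m m" "0 \<le> c"
    and "\<And>i j. i < m \<Longrightarrow> j < m \<Longrightarrow> cmod (A $$ (i, j)) \<le> c"
  shows "frobenius_norm A \<le> real m * c"
proof -
  have "(\<Sum>i<m. \<Sum>j<m. (cmod (A $$ (i, j)))\<^sup>2) \<le> (\<Sum>i<m. \<Sum>j<m. c\<^sup>2)"
    by (intro sum_mono power_mono assms) auto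
  also have "\<dots> = (real m * c)\<^sup>2"
    by (simp add: power2_eq_square)
  finally show ?thesis
    using assms(1,2) by (auto simp: frobenius_norm_def intro!: real_le_lsqrt)
qed

lemma geometric_sum_eq_0:
  fixes x :: complex
  assumes "x ^ n = 1" "x \<noteq> 1"
  shows "(\<Sum>k<n. x ^ k) = 0"
  using assms by (simp add: geometric_sum)

text \<open>\<open>q\<close> stands for p - 1, so m is \<open>q * N\<close> and n is
  \<open>Suc q * N\<close>, without subtraction on naturals.\<close>

definition vandermonde_inv :: "nat \<Rightarrow> nat \<Rightarrow> (nat \<Rightarrow> complex) \<Rightarrow> complex mat" where
  "vandermonde_inv q N z = mat (q * N) (q * N)
     (\<lambda>(j, k). (inverse (z k) ^ j - inverse (z k) ^ (q * N + j mod N)) / of_nat (Suc q * N))"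

text \<open>The terms x^j / y^j give the powers of u = x / y below m. Since x is a root of 1 + X^N +
  ... + X^(q N), the subtracted terms contribute exactly the N missing powers u^m, ...,
  u^(m+N-1).\<close>

lemma vandermonde_mult_vandermonde_inv_entry:
  fixes x y :: complex
  assumes "N > 0" and x: "x ^ (Suc q * N) = 1" "x ^ N \<noteq> 1" and y: "y ^ (Suc q * N) = 1"
  shows "(\<Sum>j<q * N. x ^ j * (inverse y ^ j - inverse y ^ (q * N + j mod N)))
           = (if x = y then of_nat (Suc q * N) else 0)"
proof -
  define m where "m = q * N"
  define w where "w = inverse y"
  define u where "u = x * w"
  \<comment> \<open>As \<open>inverse 0 = 0\<close>, this is what makes \<open>w\<close> a true
    reciprocal of \<open>y\<close>.\<close>
  have "y \<noteq> 0" using y \<open>N > 0\<close> by (auto simp: power_0_left)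
  then have u_1: "u = 1 \<longleftrightarrow> x = y" by (auto simp: u_def w_def field_simps)
  have u_n: "u ^ (Suc q * N) = 1"
    unfolding u_def w_def power_mult_distrib power_inverse x y by simp
  have "(x ^ N) ^ Suc q = 1"
    using x(1) by (metis power_mult mult.commute)
  then have "(\<Sum>a<Suc q. (x ^ N) ^ a) = 0"
    using x(2) by (rule geometric_sum_eq_0)
  \<comment> \<open>The top term, a = q, is moved to the right-hand side.\<close>
  then have cyclotomic: "(\<Sum>a<q. x ^ (a * N)) = - (x ^ m)"
    by (simp add: power_mult[symmetric] mult.commute m_def eq_neg_iff_add_eq_0)
  \<comment> \<open>With j = a N + r and r < N, the exponent of \<open>w\<close> depends on r only,
    so the sum factors into one over a and one over r.\<close>
  have "(\<Sum>j<m. x ^ j * w ^ (m + j mod N))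
      = (\<Sum>a<q. \<Sum>j = a * N..<a * N + N. x ^ j * w ^ (m + j mod N))"
    unfolding m_def by (rule sum.nat_group[symmetric])
  also have "\<dots> = (\<Sum>a<q. \<Sum>r<N. x ^ (a * N) * (w ^ m * u ^ r))"
  proof (rule sum.cong[OF refl])
    fix a
    have "(\<Sum>j = a * N..<a * N + N. x ^ j * w ^ (m + j mod N))
        = (\<Sum>r = 0..<N. x ^ (r + a * N) * w ^ (m + (r + a * N) mod N))"
      using sum.shift_bounds_nat_ivl[of "\<lambda>j. x ^ j * w ^ (m + j mod N)" 0 "a * N" N]
      by (simp add: add.commute)
    also have "\<dots> = (\<Sum>r<N. x ^ (a * N) * (w ^ m * u ^ r))"
      by (rule sum.cong) (auto simp: u_def power_add power_mult_distrib)
    finally show "(\<Sum>j = a * N..<a * N + N. x ^ j * w ^ (m + j mod N))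
        = (\<Sum>r<N. x ^ (a * N) * (w ^ m * u ^ r))" .
  qed
  also have "\<dots> = (\<Sum>a<q. x ^ (a * N)) * (\<Sum>r<N. w ^ m * u ^ r)"
    by (simp add: sum_product)
  also have "\<dots> = - (\<Sum>r<N. u ^ (m + r))"
    unfolding cyclotomic
    by (simp add: u_def power_add power_mult_distrib sum_distrib_left sum_negf mult_ac)
  finally have "(\<Sum>j<m. x ^ j * (w ^ j - w ^ (m + j mod N)))
      = (\<Sum>j<m. u ^ j) + (\<Sum>r<N. u ^ (m + r))"
    by (simp add: right_diff_distrib sum_subtractf u_def power_mult_distrib)
  also have "\<dots> = (\<Sum>j<m + N. u ^ j)"
    by (induction N) (simp_all add: add_ac)
  also have "m + N = Suc q * N"
    by (simp add: m_def)
  \<comment> \<open>For x = y every summand is 1; otherwise u is a nontrivial n-th root of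
    unity.\<close>
  also have "(\<Sum>j<Suc q * N. u ^ j) = (if x = y then of_nat (Suc q * N) else 0)"
    using geometric_sum_eq_0[OF u_n] u_1 by auto
  finally show ?thesis
    unfolding m_def w_def .
qed

text \<open>Each entry is the preceding sum divided by n; injectivity of \<open>z\<close> turns
  equality of nodes into equality of indices.\<close>

lemma vandermonde_mult_vandermonde_inv:
  assumes "N > 0" and inj: "inj_on z {..<q * N}"
    and z: "\<And>i. i < q * N \<Longrightarrow> z i ^ (Suc q * N) = 1 \<and> z i ^ N \<noteq> 1"
  shows "vandermonde_mat (q * N) z * vandermonde_inv q N z = 1\<^sub>m (q * N)"
proof (rule eq_matI)
  fix i k assume "i < dim_row (1\<^sub>m (q * N) :: complex mat)" "k < dim_col (1\<^sub>m (q * N) :: complex mat)"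
  then have ik: "i < q * N" "k < q * N" by simp_all
  have nz: "(of_nat (Suc q * N) :: complex) \<noteq> 0"
    unfolding of_nat_eq_0_iff using \<open>N > 0\<close> by simp
  have "(vandermonde_mat (q * N) z * vandermonde_inv q N z) $$ (i, k)
      = (\<Sum>j<q * N. z i ^ j * (inverse (z k) ^ j - inverse (z k) ^ (q * N + j mod N)))
          / of_nat (Suc q * N)"
    using ik by (simp add: vandermonde_mat_def vandermonde_inv_def scalar_prod_def
        lessThan_atLeast0 sum_divide_distrib del: mult_Suc of_nat_mult)
  also have "\<dots> = (if z i = z k then 1 else 0)"
    using vandermonde_mult_vandermonde_inv_entry[of N "z i" q "z k"] z ik \<open>N > 0\<close> nz
    by (simp del: mult_Suc of_nat_mult)
  also have "\<dots> = 1\<^sub>m (q * N) $$ (i, k)"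
    using ik inj_on_eq_iff[OF inj, of i k] by simp
  finally show "(vandermonde_mat (q * N) z * vandermonde_inv q N z) $$ (i, k)
      = 1\<^sub>m (q * N) $$ (i, k)" .
qed (simp_all add: vandermonde_mat_def vandermonde_inv_def)

lemma matrix_cond_vandermonde_le:
  assumes "N > 0" and inj: "inj_on z {..<q * N}"
    and z: "\<And>i. i < q * N \<Longrightarrow> z i ^ (Suc q * N) = 1 \<and> z i ^ N \<noteq> 1"
  shows "matrix_cond (vandermonde_mat (q * N) z) \<le> 2 * real (q * N)"
proof -
  define m where "m = q * N"
  define n where "n = Suc q * N"
  define V where "V = vandermonde_mat m z"
  define W where "W = vandermonde_inv q N z"
  have n: "n > 0" "m \<le> n" using \<open>N > 0\<close> by (simp_all add: n_def m_def)
  have V: "V \<in> carrier_mat m m" and W: "W \<in> carrier_mat m m"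
    by (simp_all add: V_def W_def vandermonde_mat_def vandermonde_inv_def m_def)
  obtain B where B: "mat_inverse V = Some B" "B \<in> carrier_mat m m" "B * V = 1\<^sub>m m"
    using vandermonde_mat_inverse[OF inj] unfolding V_def m_def by metis
  have VW: "V * W = 1\<^sub>m m"
    unfolding V_def W_def m_def by (rule vandermonde_mult_vandermonde_inv[OF assms])
  \<comment> \<open>A left inverse equals any right inverse, so the matrix chosen by
    \<open>mat_inverse\<close> is the explicit \<open>W\<close>.\<close>
  have "B = B * (V * W)" using B(2) VW by simp
  also have "\<dots> = W" using assoc_mult_mat[OF B(2) V W] B(3) W by simp
  finally have cond: "matrix_cond V = frobenius_norm V * frobenius_norm W"
    by (simp add: matrix_cond_def B(1))
  have norm_z: "cmod (z i) = 1" if "i < m" for i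
    using power_eq_1_iff[of "z i" n] z[of i] that n unfolding m_def n_def by (metis less_irrefl)
  have norm_V: "frobenius_norm V \<le> real m * 1"
    by (rule frobenius_norm_le[OF V]) (simp_all add: V_def vandermonde_mat_def norm_power norm_z)
  have "frobenius_norm W \<le> real m * (2 / real n)"
  proof (rule frobenius_norm_le[OF W])
    fix j k assume jk: "j < m" "k < m"
    let ?w = "inverse (z k)"
    have "cmod (?w ^ j - ?w ^ (m + j mod N)) \<le> cmod (?w ^ j) + cmod (?w ^ (m + j mod N))"
      by (rule norm_triangle_ineq4)
    also have "\<dots> = 2"
      unfolding norm_power norm_inverse norm_z[OF jk(2)] by simp
    finally have "cmod (?w ^ j - ?w ^ (m + j mod N)) / real n \<le> 2 / real n"
      by (rule divide_right_mono) simp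
    moreover have "W $$ (j, k) = (?w ^ j - ?w ^ (m + j mod N)) / of_nat n"
      using jk unfolding W_def vandermonde_inv_def m_def n_def by simp
    ultimately show "cmod (W $$ (j, k)) \<le> 2 / real n"
      by (simp add: norm_divide)
  qed simp
  also have "\<dots> \<le> 2"
    using n by (simp add: field_simps)
  finally have "frobenius_norm V * frobenius_norm W \<le> real m * 2"
    using norm_V by (intro mult_mono) (simp_all add: frobenius_norm_def sum_nonneg)
  then show ?thesis
    using cond by (simp add: V_def m_def)
qed

theorem theorem4p1:
  fixes p l n m :: nat and \<zeta> :: "nat \<Rightarrow> complex"
  assumes "prime p" and "odd p" and "l > 1"
    and "n = p ^ l" and "m = totient n"
    and "bij_betw \<zeta> {..<m} (primitive_unity_roots n)"
  shows "matrix_cond (vandermonde_mat m \<zeta>) \<le> 4 * (real p - 1) * real m"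
proof -
  define N where "N = p ^ (l - 1)"
  have p: "p > 1" using assms(1) by (rule prime_gt_1_nat)
  then have N: "N > 0" by (simp add: N_def)
  have n: "n = Suc (p - 1) * N"
    using p assms(3,4) by (simp add: N_def power_eq_if)
  have m: "m = (p - 1) * N"
    using totient_prime_power[OF assms(1), of l] assms(3-5) by (simp add: N_def)
  \<comment> \<open>Together with N > 0 this makes N one of the exponents at which a primitive n-th
    root must differ from 1.\<close>
  have "N < n" using N p by (simp add: n)
  have "matrix_cond (vandermonde_mat ((p - 1) * N) \<zeta>) \<le> 2 * real ((p - 1) * N)"
  proof (rule matrix_cond_vandermonde_le[OF N])
    show "inj_on \<zeta> {..<(p - 1) * N}"
      using assms(6) m by (simp add: bij_betw_def)
    fix i assume "i < (p - 1) * N"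
    then have "\<zeta> i \<in> primitive_unity_roots n"
      using assms(6) m by (auto simp: bij_betw_def)
    then show "\<zeta> i ^ (Suc (p - 1) * N) = 1 \<and> \<zeta> i ^ N \<noteq> 1"
      using N \<open>N < n\<close> unfolding primitive_unity_roots_def n[symmetric] by blast
  qed
  \<comment> \<open>The bound 2 m is already stronger than the claim: p \<ge> 2 gives 2 \<le> 4 (p -
    1).\<close>
  also have "2 * real ((p - 1) * N) \<le> 4 * (real p - 1) * real m"
    unfolding m[symmetric] using p by (intro mult_right_mono) auto
  finally show ?thesis by (simp add: m)
qed

end
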